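(* Let $\mathcal{C}$ be an $[n,k,d]_q$ MDS code of distance $d\ge 5$. If all the weight $2$ cosets of $\mathcal{C}$ have the same weight distribution, then $$\frac{1}{q-1}\binom{n-2}{d-2}$$ is an integer.
   Context: An $[n,k,d]_q$ code is a $k$-dimensional $\mathbb{F}_q$-linear subspace of $\mathbb{F}_q^n$ with minimum Hamming distance $d$; it is MDS if $d=n-k+1$. A coset of $\mathcal{C}$ is a translate $\mathcal{C}+\mathbf{v}$, $\mathbf{v}\in\mathbb{F}_q^n$; the weight of a coset is the smallest Hamming weight of a vector in it. The weight distribution of a coset $\mathcal{V}$ is the sequence $(B_w(\mathcal{V}))_{0\le w\le n}$, where $B_w(\mathcal{V})$ is the number of vectors of Hamming weight $w$ in $\mathcal{V}$. *)

theory Defs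
  imports "HOL-Analysis.Cartesian_Space"
begin

text \<open>
  The alphabet is a type \<open>'a :: {field, finite}\<close>, so \<open>q = CARD('a)\<close>; words of length
  \<open>n = CARD('n)\<close> are the vectors \<open>'a ^ 'n\<close>. The interpretation \<open>vec\<close> from the
  library gives linear algebra over an arbitrary field.
\<close>

definition hamming_weight :: "'a::zero ^ 'n::finite \<Rightarrow> nat" where
  "hamming_weight x = card {i. x $ i \<noteq> 0}"

definition hamming_dist :: "'a ^ 'n::finite \<Rightarrow> 'a ^ 'n \<Rightarrow> nat" where
  "hamming_dist x y = card {i. x $ i \<noteq> y $ i}"

text \<open>
  For a code with at most one word there is no pair of distinct words, and the value is
  \<open>Inf {} = 0\<close>. In particular the zero code does not count as MDS below.
\<close>

definition min_distance :: "('a ^ 'n::finite) set \<Rightarrow> nat" where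
  "min_distance C = Inf {hamming_dist x y | x y. x \<in> C \<and> y \<in> C \<and> x \<noteq> y}"

definition linear_code :: "nat \<Rightarrow> nat \<Rightarrow> nat \<Rightarrow> ('a::{field,finite} ^ 'n::finite) set \<Rightarrow> bool" where
  "linear_code n k d C \<longleftrightarrow>
     CARD('n) = n \<and> vec.subspace C \<and> vec.dim C = k \<and> min_distance C = d"

text \<open>The subtraction is not truncated, because a subspace has \<open>k \<le> n\<close>.\<close>

definition mds_code :: "nat \<Rightarrow> nat \<Rightarrow> nat \<Rightarrow> ('a::{field,finite} ^ 'n::finite) set \<Rightarrow> bool" where
  "mds_code n k d C \<longleftrightarrow> linear_code n k d C \<and> d = n - k + 1"

definition cosets :: "('a::{field,finite} ^ 'n::finite) set \<Rightarrow> ('a ^ 'n) set set" where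
  "cosets C = {(\<lambda>x. x + v) ` C | v. True}"

definition coset_weight :: "('a::zero ^ 'n::finite) set \<Rightarrow> nat" where
  "coset_weight V = Inf (hamming_weight ` V)"

definition weight_count :: "('a::zero ^ 'n::finite) set \<Rightarrow> nat \<Rightarrow> nat" where
  "weight_count V w = card {x \<in> V. hamming_weight x = w}"

definition same_weight_distribution ::
    "('a::zero ^ 'n::finite) set \<Rightarrow> ('a ^ 'n) set \<Rightarrow> bool" where
  "same_weight_distribution V V' \<longleftrightarrow>
     (\<forall>w\<le>CARD('n). weight_count V w = weight_count V' w)"

end

theory Submission
  imports Defs
begin

text \<open>
  Fix two coordinates \<open>i \<noteq> j\<close> and count the codewords of weight \<open>d\<close> that vanish at neither.
  Every \<open>d\<close>-set of coordinates is the support of exactly \<open>q - 1\<close> codewords, so there are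
  \<open>(q - 1) * ((n - 2) choose (d - 2))\<close> of them. On the other hand, for each of the
  \<open>(q - 1)\<^sup>2\<close> words \<open>v\<close> with support \<open>{i, j}\<close>, the words of weight \<open>d - 2\<close> in \<open>C + v\<close> correspond
  to the codewords of weight \<open>d\<close> that agree with \<open>- v\<close> at \<open>i\<close> and \<open>j\<close>. Since \<open>d \<ge> 5\<close>, all these
  cosets have weight 2, so by hypothesis their numbers of words of weight \<open>d - 2\<close> are one
  number \<open>B\<close>, and \<open>(q - 1) * B = (n - 2) choose (d - 2)\<close>.
\<close>

section \<open>Supports and Hamming weights\<close>

definition support :: "'a::zero ^ 'n::finite \<Rightarrow> 'n set" where
  "support x = {i. x $ i \<noteq> 0}"

lemma hamming_weight_eq_card_support: "hamming_weight x = card (support x)"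
  by (simp add: hamming_weight_def support_def)

lemma card_Compl_eq:
  fixes A :: "'a::finite set"
  shows "card (- A) = CARD('a) - card A"
  by (metis Compl_eq_Diff_UNIV card_Diff_subset finite subset_UNIV)

lemma min_distance_le_hamming_weight:
  fixes C :: "('a::{field,finite} ^ 'n::finite) set"
  assumes "vec.subspace C" "c \<in> C" "c \<noteq> 0"
  shows "min_distance C \<le> hamming_weight c"
proof -
  have "0 \<in> C"
    using assms(1) by (rule vec.subspace_0)
  moreover have "hamming_weight c = hamming_dist c 0"
    by (simp add: hamming_weight_def hamming_dist_def)
  ultimately have "hamming_weight c \<in> {hamming_dist x y | x y. x \<in> C \<and> y \<in> C \<and> x \<noteq> y}"
    using assms by blast
  then show ?thesis
    unfolding min_distance_def by (rule wellorder_Inf_le1)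
qed

section \<open>MDS codes: information sets and minimum-weight supports\<close>

lemma mds_code_le_hamming_weight:
  assumes "mds_code n k d C" "c \<in> C" "c \<noteq> 0"
  shows "d \<le> hamming_weight c"
  using assms min_distance_le_hamming_weight[of C c] by (auto simp: mds_code_def linear_code_def)

text \<open>Projection to the coordinates in \<open>T\<close> is injective on \<open>C\<close>: a
  nonzero difference vanishing on \<open>T\<close> would have weight at most
  \<open>n - k < d\<close>. Comparing dimensions, it is also onto, so values on \<open>T\<close> can
  be prescribed freely.\<close>

lemma mds_code_information_set:
  fixes C :: "('a::{field,finite} ^ 'n::finite) set"
  assumes mds: "mds_code n k d C" and T: "card T = k"
  obtains c where "c \<in> C" "\<And>i. i \<in> T \<Longrightarrow> c $ i = x $ i"
proof -
  \<comment> \<open>The projection fills up with zeros instead of shortening words, so that its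
    image and the target \<open>W\<close> are subspaces of the same space.\<close>
  define f :: "'a ^ 'n \<Rightarrow> 'a ^ 'n" where "f y = (\<chi> i. if i \<in> T then y $ i else 0)" for y
  define W :: "('a ^ 'n) set" where "W = {y. \<forall>i. i \<notin> T \<longrightarrow> y $ i = 0}"
  have sub: "vec.subspace C" and dim: "vec.dim C = k" and n: "CARD('n) = n" and d: "d = n - k + 1"
    using mds by (auto simp: mds_code_def linear_code_def)
  have lin: "Vector_Spaces.linear (*s) (*s) f"
    by unfold_locales (auto simp: f_def vec_eq_iff algebra_simps)
  have "inj_on f C"
  proof (rule inj_onI)
    fix x y assume xy: "x \<in> C" "y \<in> C" "f x = f y"
    have diff: "x - y \<in> C"
      using sub xy by (simp add: vec.subspace_diff)
    have "x $ l = y $ l" if "l \<in> T" for l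
      using arg_cong[OF xy(3), of "\<lambda>z. z $ l"] that by (simp add: f_def)
    then have "support (x - y) \<subseteq> - T"
      by (auto simp: support_def)
    then have "hamming_weight (x - y) \<le> n - k"
      using card_mono[of "- T" "support (x - y)"] T n
      by (simp add: hamming_weight_eq_card_support card_Compl_eq)
    then have "hamming_weight (x - y) < d"
      using d by simp
    then show "x = y"
      using mds_code_le_hamming_weight[OF mds diff] by force
  qed
  then have "inj_on f (vec.span C)"
    using sub by (metis vec.span_eq_iff)
  then have "vec.dim (f ` C) = k"
    using vec.dim_image_eq[OF lin] dim by blast
  moreover have "vec.subspace (f ` C)"
    using lin sub by (rule vec.linear_subspace_image)
  moreover have "vec.subspace W"
    by (auto simp: W_def vec.subspace_def)
  moreover have "f ` C \<subseteq> W"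
    by (auto simp: f_def W_def)
  moreover have "vec.dim W = k"
    using T dim_substandard_cart[of T] by (simp add: W_def)
  ultimately have "f ` C = W"
    by (simp add: vec.subspace_dim_equal)
  moreover have "f x \<in> W"
    by (auto simp: f_def W_def)
  ultimately obtain c where c: "c \<in> C" "f c = f x"
    by (metis imageE)
  then have "c $ i = x $ i" if "i \<in> T" for i
    using that by (auto simp: f_def vec_eq_iff split: if_splits)
  then show thesis
    using that c(1) by blast
qed

text \<open>Such a codeword is determined by its value at one fixed \<open>i\<close> in
  \<open>S\<close>, and every nonzero value occurs. Existence holds because
  \<open>insert i (- S)\<close> has \<open>n - d + 1 = k\<close> elements and so is an information
  set.\<close>

lemma card_mds_codewords_with_support:
  fixes C :: "('a::{field,finite} ^ 'n::finite) set"
  assumes mds: "mds_code n k d C" and S: "card S = d"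
  shows "card {c \<in> C. support c = S} = CARD('a) - 1"
proof -
  have sub: "vec.subspace C" and n: "CARD('n) = n" and d: "d = n - k + 1" and k: "k \<le> n"
    using mds dim_subset_UNIV_cart_gen[of C]
    by (auto simp: mds_code_def linear_code_def)
  have "S \<noteq> {}"
    using S d by auto
  then obtain i where i: "i \<in> S"
    by blast
  have "d \<le> n"
    using S n card_mono[of UNIV S] by simp
  then have T: "card (insert i (- S)) = k"
    using i S n d k by (simp add: card_Compl_eq)
  \<comment> \<open>A nonzero codeword has at least \<open>d = card S\<close> nonzero entries, so it
    cannot be supported on a proper subset of \<open>S\<close>.\<close>
  have supp: "support c = S" if "c \<in> C" "c \<noteq> 0" "support c \<subseteq> S" for c
    using mds_code_le_hamming_weight[OF mds that(1,2)] that(3) S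
    by (intro card_seteq) (auto simp: hamming_weight_eq_card_support)
  have "bij_betw (\<lambda>c. c $ i) {c \<in> C. support c = S} (UNIV - {0})"
    unfolding bij_betw_def
  proof
    show "inj_on (\<lambda>c. c $ i) {c \<in> C. support c = S}"
    proof (rule inj_onI)
      fix x y assume xy: "x \<in> {c \<in> C. support c = S}" "y \<in> {c \<in> C. support c = S}" "x $ i = y $ i"
      have "x - y \<in> C"
        using sub xy by (simp add: vec.subspace_diff)
      moreover have "support (x - y) \<subseteq> S" and "i \<notin> support (x - y)"
        using xy by (fastforce simp: support_def)+
      ultimately show "x = y"
        using supp[of "x - y"] i by (metis eq_iff_diff_eq_0)
    qed
    show "(\<lambda>c. c $ i) ` {c \<in> C. support c = S} = UNIV - {0}"
    proof (intro equalityI subsetI)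
      fix a :: 'a assume a: "a \<in> UNIV - {0}"
      \<comment> \<open>\<open>axis i a\<close> is only a template: it prescribes \<open>a\<close>
        at \<open>i\<close> and zero outside \<open>S\<close>.\<close>
      obtain c where c: "c \<in> C" "\<And>l. l \<in> insert i (- S) \<Longrightarrow> c $ l = axis i a $ l"
        using mds_code_information_set[OF mds T] by blast
      have "c $ i = a"
        using c(2)[of i] by simp
      have "c $ l = 0" if "l \<notin> S" for l
        using c(2)[of l] that i by (auto simp: axis_def)
      then have "support c \<subseteq> S"
        by (auto simp: support_def)
      moreover have "c \<noteq> 0"
        using a \<open>c $ i = a\<close> by auto
      ultimately have "support c = S"
        using c(1) supp by blast
      then show "a \<in> (\<lambda>c. c $ i) ` {c \<in> C. support c = S}"
        using c(1) \<open>c $ i = a\<close> by blast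
    qed (use i in \<open>force simp: support_def\<close>)
  qed
  then show ?thesis
    by (simp add: bij_betw_same_card card_Diff_singleton)
qed

section \<open>Minimum-weight codewords that are nonzero at two given coordinates\<close>

lemma card_subsets_containing_two:
  assumes fin: "finite A" and ij: "i \<in> A" "j \<in> A" "i \<noteq> j" and d: "2 \<le> d"
  shows "card {S. S \<subseteq> A \<and> card S = d \<and> i \<in> S \<and> j \<in> S} = (card A - 2) choose (d - 2)"
proof -
  have "bij_betw (\<lambda>S. S - {i, j}) {S. S \<subseteq> A \<and> card S = d \<and> i \<in> S \<and> j \<in> S}
      {S. S \<subseteq> A - {i, j} \<and> card S = d - 2}"
  proof (rule bij_betw_byWitness[where f' = "\<lambda>S. S \<union> {i, j}"])
    show "(\<lambda>S. S \<union> {i, j}) ` {S. S \<subseteq> A - {i, j} \<and> card S = d - 2}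
        \<subseteq> {S. S \<subseteq> A \<and> card S = d \<and> i \<in> S \<and> j \<in> S}"
    proof (clarsimp simp: ij)
      fix S assume S: "S \<subseteq> A - {i, j}" "card S = d - 2"
      then have "finite S" "i \<notin> S" "j \<notin> S"
        using fin finite_subset by blast+
      then show "S \<subseteq> A \<and> card (insert i (insert j S)) = d"
        using S ij d by auto
    qed
  qed (use ij d in \<open>auto simp: card_Diff_subset\<close>)
  then have "card {S. S \<subseteq> A \<and> card S = d \<and> i \<in> S \<and> j \<in> S} = card {S. S \<subseteq> A - {i, j} \<and> card S = d - 2}"
    by (rule bij_betw_same_card)
  also have "\<dots> = (card A - 2) choose (d - 2)"
    using fin ij by (simp add: n_subsets card_Diff_subset numeral_2_eq_2)
  finally show ?thesis .
qed

lemma card_mds_min_weight_codewords: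
  fixes C :: "('a::{field,finite} ^ 'n::finite) set"
  assumes mds: "mds_code n k d C" and "2 \<le> d" and "i \<noteq> j"
  shows "card {c \<in> C. hamming_weight c = d \<and> c $ i \<noteq> 0 \<and> c $ j \<noteq> 0}
    = ((n - 2) choose (d - 2)) * (CARD('a) - 1)"
proof -
  define P where "P = {S :: 'n set. S \<subseteq> UNIV \<and> card S = d \<and> i \<in> S \<and> j \<in> S}"
  have "{c \<in> C. hamming_weight c = d \<and> c $ i \<noteq> 0 \<and> c $ j \<noteq> 0}
      = (\<Union>S\<in>P. {c \<in> C. support c = S})"
    by (auto simp: P_def hamming_weight_eq_card_support support_def)
  also have "card \<dots> = (\<Sum>S\<in>P. card {c \<in> C. support c = S})"
    by (rule card_UN_disjoint) auto
  also have "\<dots> = card P * (CARD('a) - 1)"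
    using card_mds_codewords_with_support[OF mds] by (simp add: P_def)
  also have "card P = (n - 2) choose (d - 2)"
    using card_subsets_containing_two[of UNIV i j d] assms
    by (simp add: P_def mds_code_def linear_code_def)
  finally show ?thesis .
qed

section \<open>Cosets of weight 2\<close>

lemma support_axis_add_axis:
  assumes "i \<noteq> j" "a \<noteq> 0" "b \<noteq> 0"
  shows "support (axis i a + axis j b :: 'a::monoid_add ^ 'n::finite) = {i, j}"
  using assms by (auto simp: support_def axis_def)

text \<open>The minimum is attained at \<open>v\<close>. Adding \<open>v\<close> to a nonzero
  codeword lowers the weight by at most 2, which leaves at least
  \<open>d - 2 \<ge> 2\<close>.\<close>

lemma mds_coset_weight_eq_2:
  fixes C :: "('a::{field,finite} ^ 'n::finite) set"
  assumes mds: "mds_code n k d C" and d: "4 \<le> d" and v: "hamming_weight v = 2"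
  shows "coset_weight ((\<lambda>x. x + v) ` C) = 2"
proof -
  have "0 \<in> C"
    using mds by (simp add: mds_code_def linear_code_def vec.subspace_0)
  have "2 \<le> hamming_weight (c + v)" if c: "c \<in> C" for c
  proof (cases "c = 0")
    case False
    have "support c \<subseteq> support (c + v) \<union> support v"
      by (auto simp: support_def)
    then have "card (support c) \<le> card (support (c + v) \<union> support v)"
      by (intro card_mono) auto
    also have "\<dots> \<le> card (support (c + v)) + card (support v)"
      by (rule card_Un_le)
    finally show ?thesis
      using mds_code_le_hamming_weight[OF mds c False] d v
      by (simp add: hamming_weight_eq_card_support)
  qed (simp add: v)
  then show ?thesis
    unfolding coset_weight_def using \<open>0 \<in> C\<close> v
    by (intro cInf_eq_minimum) (auto intro!: image_eqI[of _ _ v] image_eqI[of _ _ 0])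
qed

text \<open>Translation by \<open>v\<close> is the bijection. A nonzero codeword has weight at least
  \<open>d\<close>, so adding \<open>v\<close> can bring it down to \<open>d - 2\<close> only by
  cancelling both entries at \<open>i\<close> and \<open>j\<close>.\<close>

lemma mds_coset_weight_count:
  fixes C :: "('a::{field,finite} ^ 'n::finite) set"
  assumes mds: "mds_code n k d C" and d: "5 \<le> d" and v: "support v = {i, j}" and ij: "i \<noteq> j"
  shows "weight_count ((\<lambda>x. x + v) ` C) (d - 2)
    = card {c \<in> C. hamming_weight c = d \<and> c $ i = - v $ i \<and> c $ j = - v $ j}"
    (is "_ = card ?A")
proof -
  have nz: "v $ i \<noteq> 0" "v $ j \<noteq> 0"
    using v by (auto simp: support_def)
  have z: "v $ l = 0" if "l \<notin> {i, j}" for l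
    using v that by (auto simp: support_def)
  have "{x \<in> (\<lambda>x. x + v) ` C. hamming_weight x = d - 2} = (\<lambda>x. x + v) ` ?A"
  proof (intro equalityI subsetI)
    fix x assume "x \<in> {x \<in> (\<lambda>x. x + v) ` C. hamming_weight x = d - 2}"
    then obtain c where c: "c \<in> C" "x = c + v" and w: "card (support x) = d - 2"
      by (auto simp: hamming_weight_eq_card_support)
    \<comment> \<open>Otherwise \<open>x = v\<close> would have weight 2, but
      \<open>d - 2 \<ge> 3\<close>. For \<open>d = 4\<close> the word \<open>v\<close> itself would
      spoil the count.\<close>
    have "c \<noteq> 0"
      using c(2) w v ij d by auto
    then have ge: "d \<le> card (support c)"
      using mds_code_le_hamming_weight[OF mds c(1)] by (simp add: hamming_weight_eq_card_support)
    have sub: "support c \<subseteq> support x \<union> {i, j}"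
      using z c(2) by (auto simp: support_def)
    have le: "card (support c) \<le> card (support x \<union> {i, j})"
      using sub by (intro card_mono) auto
    \<comment> \<open>The union has at least \<open>d\<close> elements because it contains
      \<open>support c\<close>, so nothing remains for the intersection.\<close>
    have "card (support x \<union> {i, j}) + card (support x \<inter> {i, j}) = d"
      using card_Un_Int[of "support x" "{i, j}"] w ij d by simp
    then have "card (support x \<inter> {i, j}) = 0" and "card (support c) = d"
      using ge le by linarith+
    then have "x $ i = 0" "x $ j = 0"
      by (auto simp: support_def)
    then have "c $ i = - v $ i" "c $ j = - v $ j"
      using c(2) by (auto simp: eq_neg_iff_add_eq_0)
    then show "x \<in> (\<lambda>x. x + v) ` ?A"
      using c \<open>card (support c) = d\<close> by (auto simp: hamming_weight_eq_card_support)
  next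
    fix x assume "x \<in> (\<lambda>x. x + v) ` ?A"
    then obtain c where c: "c \<in> C" "x = c + v" "card (support c) = d"
      and ci: "c $ i = - v $ i" and cj: "c $ j = - v $ j"
      by (auto simp: hamming_weight_eq_card_support)
    have "x $ l \<noteq> 0 \<longleftrightarrow> c $ l \<noteq> 0 \<and> l \<notin> {i, j}" for l
    proof (cases "l \<in> {i, j}")
      case True
      then have "c $ l = - v $ l"
        using ci cj by blast
      then show ?thesis
        using True c(2) by (simp only: vector_add_component) simp
    next
      case False
      then show ?thesis
        using z[of l] c(2) by simp
    qed
    then have "support x = support c - {i, j}"
      by (auto simp: support_def)
    moreover have "{i, j} \<subseteq> support c"
      using ci cj nz by (auto simp: support_def)
    ultimately have "card (support x) = d - 2"
      using c(3) ij by (simp add: card_Diff_subset)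
    then show "x \<in> {x \<in> (\<lambda>x. x + v) ` C. hamming_weight x = d - 2}"
      using c by (auto simp: hamming_weight_eq_card_support)
  qed
  then show ?thesis
    by (simp add: weight_count_def card_image)
qed

section \<open>Double counting over the values at two coordinates\<close>

theorem theorem5p4:
  fixes C :: "('a::{field,finite} ^ 'n::finite) set"
    and n k d q :: nat
  assumes "q = CARD('a)"
    and "mds_code n k d C"
    and "d \<ge> 5"
    and "\<forall>V\<in>cosets C. \<forall>V'\<in>cosets C.
           coset_weight V = 2 \<longrightarrow> coset_weight V' = 2 \<longrightarrow> same_weight_distribution V V'"
  shows "1 / (real q - 1) * real ((n - 2) choose (d - 2)) \<in> \<int>"
proof -
  have n: "CARD('n) = n" and dn: "d = n - k + 1"
    using assms(2) by (auto simp: mds_code_def linear_code_def)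
  have "\<not> card (UNIV :: 'n set) \<le> 1"
    using n dn assms(3) by simp
  then obtain i j :: 'n where ij: "i \<noteq> j"
    by (auto simp: card_le_Suc0_iff_eq)
  \<comment> \<open>The signs are chosen so that words of weight \<open>d - 2\<close> in the coset
    of \<open>v p\<close> correspond to codewords with the values \<open>p\<close> itself at
    \<open>i\<close> and \<open>j\<close>.\<close>
  define v :: "'a \<times> 'a \<Rightarrow> 'a ^ 'n" where "v = (\<lambda>(a, b). axis i (- a) + axis j (- b))"
  define Q :: "('a \<times> 'a) set" where "Q = (UNIV - {0}) \<times> (UNIV - {0})"
  define F where "F p = {c \<in> C. hamming_weight c = d \<and> c $ i = fst p \<and> c $ j = snd p}" for p
  \<comment> \<open>The pair \<open>(1, 1)\<close> is an arbitrary reference point in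
    \<open>Q\<close>.\<close>
  define B where "B = card (F (1, 1))"
  have supp: "support (v p) = {i, j}" if "p \<in> Q" for p
    using that ij by (auto simp: v_def Q_def support_axis_add_axis)
  have F: "card (F p) = weight_count ((\<lambda>x. x + v p) ` C) (d - 2)" if "p \<in> Q" for p
    using mds_coset_weight_count[OF assms(2,3) supp[OF that] ij] ij
    by (auto simp: F_def v_def axis_def split: prod.splits)
  have cw: "coset_weight ((\<lambda>x. x + v p) ` C) = 2" if "p \<in> Q" for p
    using mds_coset_weight_eq_2[OF assms(2)] assms(3) supp[OF that] ij
    by (simp add: hamming_weight_eq_card_support)
  have "(1, 1) \<in> Q"
    by (simp add: Q_def)
  have FB: "card (F p) = B" if "p \<in> Q" for p
  proof -
    have "same_weight_distribution ((\<lambda>x. x + v p) ` C) ((\<lambda>x. x + v (1, 1)) ` C)"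
      using assms(4) cw[OF that] cw[OF \<open>(1, 1) \<in> Q\<close>] unfolding cosets_def by blast
    \<comment> \<open>Weight distributions are compared only at weights up to the length.\<close>
    moreover have "d - 2 \<le> CARD('n)"
      using n dn by simp
    ultimately show ?thesis
      using F[OF that] F[OF \<open>(1, 1) \<in> Q\<close>] by (simp add: B_def same_weight_distribution_def)
  qed
  have "((n - 2) choose (d - 2)) * (q - 1)
      = card {c \<in> C. hamming_weight c = d \<and> c $ i \<noteq> 0 \<and> c $ j \<noteq> 0}"
    using card_mds_min_weight_codewords[OF assms(2) _ ij] assms(1,3) by simp
  also have "{c \<in> C. hamming_weight c = d \<and> c $ i \<noteq> 0 \<and> c $ j \<noteq> 0} = (\<Union>p\<in>Q. F p)"
    by (auto simp: F_def Q_def)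
  also have "card \<dots> = (\<Sum>p\<in>Q. card (F p))"
    by (rule card_UN_disjoint) (auto simp: F_def)
  also have "\<dots> = (q - 1) * (q - 1) * B"
    using FB by (simp add: Q_def card_cartesian_product card_Diff_singleton assms(1))
  finally have eq: "((n - 2) choose (d - 2)) * (q - 1) = (q - 1) * (q - 1) * B" .
  \<comment> \<open>With \<open>q \<ge> 2\<close> a factor \<open>q - 1\<close> can be cancelled,
    and the natural subtraction agrees with the real one.\<close>
  have "card {0, 1 :: 'a} \<le> CARD('a)"
    by (rule card_mono) auto
  then have q: "2 \<le> q"
    using assms(1) by simp
  with eq have "(n - 2) choose (d - 2) = (q - 1) * B"
    by simp
  then have "1 / (real q - 1) * real ((n - 2) choose (d - 2)) = real B"
    using q by (simp add: of_nat_diff)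
  then show ?thesis
    by simp
qed

end
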